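(* Let $G$ be a finite group, $H \le G$ an abelian subgroup, and $\Omega\subseteq G$ a transversal for $G/H$. Given a range function $J$, that is, a mapping $J \colon \hat H \to \{\text{subspaces of } L^2(\Omega)\}$, put $$V_J := \{ f\in L^2(G) : (Z_r f)(\alpha) \in J(\alpha)\ \forall \alpha\in\hat H\}.$$ Then the mapping $J \mapsto V_J$ is a one-to-one correspondence (bijection) between range functions and right $H$-shift invariant subspaces of $L^2(G)$.
   Context: $\hat H$ is the group of characters $\alpha\colon H\to\mathbb{T}$. A transversal for $G/H$ contains exactly one element of each left coset $xH$. $L^2(G)$ and $L^2(\Omega)$ are the spaces of complex functions on $G$ and $\Omega$ (counting measure). For $f\in L^2(G)$ and $\alpha\in\hat H$, $(Z_r f)(\alpha)\in L^2(\Omega)$ is the function $(Z_r f)(\alpha)(x) = \sum_{h\in H} f(xh)\,\alpha(h)$, $x\in\Omega$. Right translation by $h \in H$ is $(R_h f)(x) = f(xh)$. A (linear) subspace $V\subseteq L^2(G)$ is called right $H$-shift invariant if $R_h V = V$ for every $h\in H$. *)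

theory Defs
  imports Complex_Main "HOL-Algebra.Left_Coset" "HOL-Library.Function_Algebras"
begin

text \<open>
  The library theory of vector spaces is instantiated with the complex functions on a type under
  the pointwise operations. The prefix \<open>cfun\<close> then gives access to its notion of a linear subspace.
\<close>

definition cfun_scale :: "complex \<Rightarrow> ('a \<Rightarrow> complex) \<Rightarrow> 'a \<Rightarrow> complex"
  where "cfun_scale c f = (\<lambda>x. c * f x)"

global_interpretation cfun: vector_space cfun_scale
  by unfold_locales (simp_all add: cfun_scale_def plus_fun_def algebra_simps)

text \<open>
  A function on a subset \<open>A\<close> of a type is encoded by its extension by zero. As only finite sets
  \<open>A\<close> occur, square-summability is automatic, and the linear structure is all that is used.
\<close>

definition L2 :: "'a set \<Rightarrow> ('a \<Rightarrow> complex) set"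
  where "L2 A = {f. \<forall>x. x \<notin> A \<longrightarrow> f x = 0}"

definition subspaces_L2 :: "'a set \<Rightarrow> ('a \<Rightarrow> complex) set set"
  where "subspaces_L2 A = {S. S \<subseteq> L2 A \<and> cfun.subspace S}"

definition circle_group :: "complex monoid"
  where "circle_group = \<lparr>carrier = {z. cmod z = 1}, mult = (*), one = 1\<rparr>"

text \<open>
  Characters are functions on \<open>H\<close>; being \<open>extensional\<close>, they are determined by
  their values there.
\<close>

definition characters :: "('a, 'b) monoid_scheme \<Rightarrow> 'a set \<Rightarrow> ('a \<Rightarrow> complex) set"
  where "characters G H = hom (G\<lparr>carrier := H\<rparr>) circle_group \<inter> extensional H"

definition transversal :: "('a, 'b) monoid_scheme \<Rightarrow> 'a set \<Rightarrow> 'a set \<Rightarrow> bool"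
  where "transversal G H \<Omega> \<longleftrightarrow>
    \<Omega> \<subseteq> carrier G \<and> (\<forall>C \<in> lcosets\<^bsub>G\<^esub> H. \<exists>!x. x \<in> \<Omega> \<and> x \<in> C)"

definition Zr :: "('a, 'b) monoid_scheme \<Rightarrow> 'a set \<Rightarrow> 'a set \<Rightarrow>
    ('a \<Rightarrow> complex) \<Rightarrow> ('a \<Rightarrow> complex) \<Rightarrow> 'a \<Rightarrow> complex"
  where "Zr G H \<Omega> f \<alpha> = (\<lambda>x. if x \<in> \<Omega> then \<Sum>h\<in>H. f (x \<otimes>\<^bsub>G\<^esub> h) * \<alpha> h else 0)"

definition right_translation ::
    "('a, 'b) monoid_scheme \<Rightarrow> 'a \<Rightarrow> ('a \<Rightarrow> complex) \<Rightarrow> 'a \<Rightarrow> complex"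
  where "right_translation G h f = (\<lambda>x. if x \<in> carrier G then f (x \<otimes>\<^bsub>G\<^esub> h) else 0)"

definition shift_invariant_subspaces ::
    "('a, 'b) monoid_scheme \<Rightarrow> 'a set \<Rightarrow> ('a \<Rightarrow> complex) set set"
  where "shift_invariant_subspaces G H =
    {V \<in> subspaces_L2 (carrier G). \<forall>h\<in>H. right_translation G h ` V = V}"

definition range_functions :: "('a, 'b) monoid_scheme \<Rightarrow> 'a set \<Rightarrow> 'a set \<Rightarrow>
    (('a \<Rightarrow> complex) \<Rightarrow> ('a \<Rightarrow> complex) set) set"
  where "range_functions G H \<Omega> = characters G H \<rightarrow>\<^sub>E subspaces_L2 \<Omega>"

definition range_space :: "('a, 'b) monoid_scheme \<Rightarrow> 'a set \<Rightarrow> 'a set \<Rightarrow>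
    (('a \<Rightarrow> complex) \<Rightarrow> ('a \<Rightarrow> complex) set) \<Rightarrow> ('a \<Rightarrow> complex) set"
  where "range_space G H \<Omega> J =
    {f \<in> L2 (carrier G). \<forall>\<alpha>\<in>characters G H. Zr G H \<Omega> f \<alpha> \<in> J \<alpha>}"

end

theory Submission
  imports Defs "HOL-Algebra.Multiplicative_Group"
begin

text \<open>
  Character orthogonality on \<open>H\<close> makes the Zak transform invertible: \<open>f\<close> is the sum over all
  characters \<open>\<alpha>\<close> of the functions reconstructed from \<open>(Z\<^sub>r f)(\<alpha>)\<close> alone. Each of these summands is
  the combination \<open>|H|\<^sup>-\<^sup>1 \<Sum>\<^sub>h \<alpha>(h) R\<^sub>h f\<close> of right translates of \<open>f\<close>, so a shift-invariant subspace
  \<open>V\<close> is recovered from its fibres \<open>{(Z\<^sub>r f)(\<alpha>) | f \<in> V}\<close>; conversely these fibres of \<open>V\<^sub>J\<close> are the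
  \<open>J(\<alpha>)\<close>, since values of the transform at different characters can be prescribed independently.
  That the characters separate the points of \<open>H\<close> is shown by producing a simultaneous eigenfunction
  of all translations; its eigenvalues form a character.
\<close>

subsection \<open>Characters of a finite abelian group\<close>

lemma sum_power_roots_unity:
  fixes n j :: nat
  assumes "0 < j" "j < n"
  shows "(\<Sum>w | w ^ n = (1::complex). w ^ j) = 0"
proof -
  let ?r = "\<lambda>k. cis (2 * pi * real k / real n)"
  have bij: "bij_betw ?r {..<n} {w. w ^ n = 1}"
    using assms by (intro bij_betw_roots_unity) simp
  have "?r j ^ n = 1"
    using assms bij_betwE[OF bij] by simp
  moreover have "?r j \<noteq> 1"
    using inj_onD[OF bij_betw_imp_inj_on[OF bij], of j 0] assms by auto
  ultimately have "(\<Sum>k<n. ?r j ^ k) = 0"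
    by (simp add: geometric_sum)
  \<comment> \<open>De Moivre exchanges index and exponent, so the sum becomes the geometric series
    of \<open>?r j\<close>, an \<open>n\<close>-th root of unity other than 1.\<close>
  moreover have "?r k ^ j = ?r j ^ k" for k
    by (simp add: DeMoivre mult.commute mult.left_commute)
  ultimately show ?thesis
    by (simp add: sum.reindex_bij_betw[OF bij, symmetric])
qed

context comm_group
begin

text \<open>Summed over all roots of unity \<open>w\<close>, the averages give back \<open>n\<close> times \<open>f\<close>.\<close>

lemma averaging_nonzero:
  fixes f :: "'a \<Rightarrow> complex"
  assumes n: "n > 0" and x: "x \<in> carrier G" "f x \<noteq> 0"
  shows "\<exists>w. w ^ n = 1 \<and> (\<Sum>j<n. w ^ j * f (x \<otimes> a [^] j)) \<noteq> 0"
proof (rule ccontr)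
  assume "\<not> ?thesis"
  hence "0 = (\<Sum>w | w ^ n = (1::complex). \<Sum>j<n. w ^ j * f (x \<otimes> a [^] j))"
    by simp
  also have "\<dots> = (\<Sum>j<n. (\<Sum>w | w ^ n = (1::complex). w ^ j) * f (x \<otimes> a [^] j))"
    by (subst sum.swap) (simp add: sum_distrib_right)
  also have "\<dots> = (\<Sum>j<n. if j = 0 then of_nat n * f x else 0)"
    using n x by (intro sum.cong) (auto simp: sum_power_roots_unity card_roots_unity_eq)
  also have "\<dots> = of_nat n * f x"
    using n by simp
  finally show False
    using n x by simp
qed

text \<open>Translation by \<open>a\<close> shifts the index \<open>j\<close> by one at the cost of
  a factor \<open>inverse w\<close>; the boundary terms \<open>j = 0\<close> and
  \<open>j = n\<close> agree since \<open>w ^ n = 1\<close> and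
  \<open>a [^] n = \<one>\<close>.\<close>

lemma averaging_eigenfunction:
  fixes f :: "'a \<Rightarrow> complex" and n :: nat
  assumes "n > 0" "w ^ n = 1" and a: "a \<in> carrier G" "a [^] n = \<one>" and x: "x \<in> carrier G"
  shows "(\<Sum>j<n. w ^ j * f (x \<otimes> a \<otimes> a [^] j)) = inverse w * (\<Sum>j<n. w ^ j * f (x \<otimes> a [^] j))"
proof -
  let ?F = "\<lambda>j. w ^ j * f (x \<otimes> a [^] j)"
  have w: "w \<noteq> 0"
    using assms by (auto simp: power_0_left)
  have "w * (\<Sum>j<n. w ^ j * f (x \<otimes> a \<otimes> a [^] j)) = (\<Sum>j<n. ?F (Suc j))"
    using a x by (simp add: sum_distrib_left m_ac mult_ac)
  also have "\<dots> = (\<Sum>j<n. ?F j)"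
    using sum.lessThan_Suc_shift[of ?F n] sum.lessThan_Suc[of ?F n] assms by simp
  finally show ?thesis
    using w by (simp add: field_simps)
qed

text \<open>Averaging a joint eigenfunction over the powers of a new element \<open>b\<close> makes
  it an eigenfunction for \<open>b\<close> too, and commutativity preserves the earlier eigenvalues.
  The eigenvalue at \<open>a\<close> is fixed in the base case and never changed.\<close>

lemma simultaneous_eigenfunction:
  assumes fin: "finite (carrier G)" and a: "a \<in> carrier G" "a \<noteq> \<one>"
    and T: "finite T" "T \<subseteq> carrier G"
  shows "\<exists>c::'a \<Rightarrow> complex. c a \<noteq> 1 \<and> (\<exists>f::'a \<Rightarrow> complex. (\<exists>x\<in>carrier G. f x \<noteq> 0) \<and>
    (\<forall>h\<in>insert a T. \<forall>x\<in>carrier G. f (x \<otimes> h) = c h * f x))"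
  using T
proof (induction T)
  case empty
  define n where "n = order G"
  have n: "n > 0" and pow: "a [^] n = \<one>"
    using fin a by (auto simp: n_def order_gt_0_iff_finite pow_order_eq_1)
  \<comment> \<open>the average of \<open>f\<close> with \<open>w = 1\<close> telescopes to zero\<close>
  define f where "f = (\<lambda>x. (if x = \<one> then 1 else 0) - (if x \<otimes> a = \<one> then 1 else (0::complex)))"
  have "f \<one> \<noteq> 0"
    using a by (simp add: f_def)
  then obtain w where w: "w ^ n = 1" and nz: "(\<Sum>j<n. w ^ j * f (\<one> \<otimes> a [^] j)) \<noteq> 0"
    using averaging_nonzero[OF n, of \<one> f a] by auto
  have "(\<Sum>j<n. f (a [^] j)) = (\<Sum>j<n. (if a [^] j = \<one> then 1 else 0) - (if a [^] Suc j = \<one> then 1 else 0))"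
    by (simp add: f_def)
  also have "\<dots> = 0"
    using pow by (subst sum_lessThan_telescope') simp
  finally have "w \<noteq> 1"
    using nz a by auto
  thus ?case
    using nz averaging_eigenfunction[OF n w a(1) pow, of _ f]
    by (intro exI[of _ "\<lambda>_. inverse w"] conjI exI[of _ "\<lambda>x. \<Sum>j<n. w ^ j * f (x \<otimes> a [^] j)"])
       (auto intro: bexI[of _ \<one>])
next
  case (insert b T)
  then obtain c :: "'a \<Rightarrow> complex" where c: "c a \<noteq> 1" and
    "\<exists>f::'a \<Rightarrow> complex. (\<exists>x\<in>carrier G. f x \<noteq> 0) \<and>
      (\<forall>h\<in>insert a T. \<forall>x\<in>carrier G. f (x \<otimes> h) = c h * f x)"
    by auto
  then obtain f x where x: "x \<in> carrier G" "f x \<noteq> 0"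
    and f: "\<And>h x. h \<in> insert a T \<Longrightarrow> x \<in> carrier G \<Longrightarrow> f (x \<otimes> h) = c h * f x"
    by blast
  show ?case
  \<comment> \<open>If \<open>b = a\<close> the old eigenfunction serves; redefining
    \<open>c\<close> at \<open>a\<close> could lose \<open>c a \<noteq> 1\<close>.\<close>
  proof (cases "b = a")
    case True
    thus ?thesis
      using c f x by (intro exI[of _ c] conjI exI[of _ f]) auto
  next
    case False
    define n where "n = order G"
    have b: "b \<in> carrier G" and T: "T \<subseteq> carrier G"
      using insert.prems by auto
    have n: "n > 0" and pow: "b [^] n = \<one>"
      using fin b by (auto simp: n_def order_gt_0_iff_finite pow_order_eq_1)
    obtain w where w: "w ^ n = 1" and nz: "(\<Sum>j<n. w ^ j * f (x \<otimes> b [^] j)) \<noteq> 0"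
      using averaging_nonzero[OF n, of x f b] x by blast
    define g where "g = (\<lambda>x. \<Sum>j<n. w ^ j * f (x \<otimes> b [^] j))"
    have "g (y \<otimes> h) = c h * g y" if h: "h \<in> insert a T" and y: "y \<in> carrier G" for h y
    proof -
      have hG: "h \<in> carrier G"
        using h T a by auto
      have "y \<otimes> h \<otimes> b [^] j = y \<otimes> b [^] j \<otimes> h" for j :: nat
        using y hG b by (simp add: m_ac)
      thus ?thesis
        using h y b f by (simp add: g_def sum_distrib_left mult_ac)
    qed
    moreover have "g (y \<otimes> b) = inverse w * g y" if "y \<in> carrier G" for y
      using averaging_eigenfunction[OF n w b pow that] by (simp add: g_def)
    \<comment> \<open>Here \<open>b\<close> lies outside \<open>insert a T\<close>, so updating
      \<open>c\<close> at \<open>b\<close> leaves the earlier eigenvalues intact.\<close>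
    ultimately show ?thesis
      using c x nz False insert.hyps
      by (intro exI[of _ "c(b := inverse w)"] conjI exI[of _ g]) (auto simp: g_def)
  qed
qed

section \<open>Existence of enough characters\<close>

lemma charactersI:
  assumes "\<And>h k. h \<in> carrier G \<Longrightarrow> k \<in> carrier G \<Longrightarrow> c (h \<otimes> k) = c h * c k"
    and "\<And>h. h \<in> carrier G \<Longrightarrow> cmod (c h) = 1"
  shows "restrict c (carrier G) \<in> characters G (carrier G)"
  using assms by (auto simp: characters_def circle_group_def intro!: homI)

text \<open>The joint eigenvalues are multiplicative, because a translation by a product can be done
  in two steps from a point where \<open>f\<close> is nonzero. They have modulus 1, being roots of
  unity in a finite group.\<close>

lemma characters_separate:
  assumes fin: "finite (carrier G)" and a: "a \<in> carrier G" "a \<noteq> \<one>"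
  shows "\<exists>\<chi>\<in>characters G (carrier G). \<chi> a \<noteq> 1"
proof -
  obtain c f :: "'a \<Rightarrow> complex" and x where c: "c a \<noteq> 1" and x: "x \<in> carrier G" "f x \<noteq> 0"
    and f: "\<And>h x. h \<in> carrier G \<Longrightarrow> x \<in> carrier G \<Longrightarrow> f (x \<otimes> h) = c h * f x"
    using simultaneous_eigenfunction[OF fin a fin order_refl] a by auto
  have mult: "c (h \<otimes> k) = c h * c k" if "h \<in> carrier G" "k \<in> carrier G" for h k
  proof -
    have "c (h \<otimes> k) * f x = c h * c k * f x"
      using that x f[of "h \<otimes> k" x] f[of k "x \<otimes> h"] f[of h x] by (simp add: m_assoc)
    thus ?thesis
      using x by simp
  qed
  have one: "c \<one> = 1"
    using f[of \<one> x] x by simp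
  have pow: "c (h [^] k) = c h ^ k" if "h \<in> carrier G" for h and k :: nat
    using that by (induction k) (simp_all add: one mult)
  have norm: "cmod (c h) = 1" if "h \<in> carrier G" for h
  proof -
    have "c h ^ order G = 1"
      using pow[OF that, of "order G"] that by (simp add: pow_order_eq_1 one)
    thus ?thesis
      using fin by (auto dest: power_eq_1_iff simp: order_gt_0_iff_finite[symmetric])
  qed
  have "restrict c (carrier G) \<in> characters G (carrier G)"
    using mult norm by (rule charactersI)
  thus ?thesis
    using c a by (intro bexI[of _ "restrict c (carrier G)"]) auto
qed

section \<open>Character identities and orthogonality relations\<close>

lemma
  assumes "\<chi> \<in> characters G (carrier G)"
  shows character_mult:
      "h \<in> carrier G \<Longrightarrow> k \<in> carrier G \<Longrightarrow> \<chi> (h \<otimes> k) = \<chi> h * \<chi> k"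
    and cmod_character: "h \<in> carrier G \<Longrightarrow> cmod (\<chi> h) = 1"
    and character_extensional: "\<chi> \<in> extensional (carrier G)"
  using assms by (auto simp: characters_def circle_group_def hom_def)

lemma character_one:
  assumes "\<chi> \<in> characters G (carrier G)"
  shows "\<chi> \<one> = 1"
  using character_mult[OF assms, of \<one> \<one>] cmod_character[OF assms, of \<one>]
  by (cases "\<chi> \<one> = 0") auto

lemma character_mult_cnj:
  assumes "\<chi> \<in> characters G (carrier G)" "h \<in> carrier G"
  shows "\<chi> h * cnj (\<chi> h) = 1"
  using cmod_character[OF assms] by (simp add: complex_norm_square[symmetric])

lemma character_inv:
  assumes "\<chi> \<in> characters G (carrier G)" "h \<in> carrier G"
  shows "\<chi> (inv h) = cnj (\<chi> h)"
proof -
  have "\<chi> (inv h) = \<chi> (inv h) * (\<chi> h * cnj (\<chi> h))"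
    using assms by (simp add: character_mult_cnj)
  also have "\<dots> = \<chi> (inv h \<otimes> h) * cnj (\<chi> h)"
    using assms character_mult[OF assms(1), of "inv h" h] by simp
  finally show ?thesis
    using assms by (simp add: character_one)
qed

text \<open>All values are roots of unity of order dividing \<open>order G\<close>, and
  extensionality leaves no freedom outside the carrier.\<close>

lemma finite_characters:
  assumes fin: "finite (carrier G)"
  shows "finite (characters G (carrier G))"
proof (rule finite_subset)
  show "characters G (carrier G) \<subseteq> carrier G \<rightarrow>\<^sub>E {z. z ^ order G = 1}"
  proof
    fix \<chi> assume \<chi>: "\<chi> \<in> characters G (carrier G)"
    have "\<chi> (h [^] k) = \<chi> h ^ k" if "h \<in> carrier G" for h and k :: nat
      using that by (induction k) (simp_all add: character_one[OF \<chi>] character_mult[OF \<chi>])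
    from this[of _ "order G"] show "\<chi> \<in> carrier G \<rightarrow>\<^sub>E {z. z ^ order G = 1}"
      using character_extensional[OF \<chi>] character_one[OF \<chi>]
      by (auto simp: PiE_def pow_order_eq_1)
  qed
  show "finite (carrier G \<rightarrow>\<^sub>E {z::complex. z ^ order G = 1})"
    using fin order_gt_0_iff_finite by (intro finite_PiE finite_nth_roots) auto
qed

text \<open>Translating the summation variable by an element where the characters differ multiplies
  the sum by a factor other than 1.\<close>

lemma character_orthogonality:
  assumes \<chi>: "\<chi> \<in> characters G (carrier G)" and \<psi>: "\<psi> \<in> characters G (carrier G)"
  shows "(\<Sum>h\<in>carrier G. \<chi> h * cnj (\<psi> h)) = (if \<chi> = \<psi> then of_nat (order G) else 0)"
proof (cases "\<chi> = \<psi>")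
  case True
  thus ?thesis
    using \<chi> by (simp add: character_mult_cnj order_def)
next
  case False
  then obtain k where k: "k \<in> carrier G" "\<chi> k \<noteq> \<psi> k"
    using \<chi> \<psi> character_extensional extensionalityI by metis
  let ?F = "\<lambda>h. \<chi> h * cnj (\<psi> h)"
  have "(\<Sum>h\<in>carrier G. ?F h) = (\<Sum>h\<in>carrier G. ?F (k \<otimes> h))"
    using k by (intro sum.reindex_bij_witness[of _ "\<lambda>h. k \<otimes> h" "\<lambda>h. inv k \<otimes> h"])
      (auto simp: m_assoc[symmetric])
  also have "\<dots> = ?F k * (\<Sum>h\<in>carrier G. ?F h)"
    using k \<chi> \<psi> by (simp add: sum_distrib_left character_mult mult_ac)
  finally have "?F k = 1 \<or> (\<Sum>h\<in>carrier G. ?F h) = 0"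
    using mult_cancel_right1 by metis
  moreover have "?F k \<noteq> 1"
  proof
    assume "?F k = 1"
    \<comment> \<open>After multiplication by \<open>\<psi> k\<close>, modulus 1 would force
      \<open>\<chi> k = \<psi> k\<close>.\<close>
    hence "\<chi> k * (\<psi> k * cnj (\<psi> k)) = \<psi> k"
      by (simp add: mult_ac)
    thus False
      using k character_mult_cnj[OF \<psi>] by simp
  qed
  ultimately show ?thesis
    using False by simp
qed

text \<open>The dual orthogonality relation. Away from \<open>\<one>\<close>, multiplication by a
  character \<open>\<beta>\<close> with \<open>\<beta> h \<noteq> 1\<close> permutes the characters
  and scales the sum by \<open>\<beta> h\<close>, so it vanishes.\<close>

lemma sum_characters:
  assumes fin: "finite (carrier G)" and h: "h \<in> carrier G"
  shows "(\<Sum>\<chi>\<in>characters G (carrier G). \<chi> h) = (if h = \<one> then of_nat (order G) else 0)"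
proof -
  let ?C = "characters G (carrier G)"
  have vanish: "(\<Sum>\<chi>\<in>?C. \<chi> h) = 0" if h: "h \<in> carrier G" and "h \<noteq> \<one>" for h
  proof -
    obtain \<beta> where \<beta>: "\<beta> \<in> ?C" "\<beta> h \<noteq> 1"
      using characters_separate[OF fin h \<open>h \<noteq> \<one>\<close>] by blast
    have "(\<Sum>\<chi>\<in>?C. \<chi> h) = (\<Sum>\<chi>\<in>?C. (\<lambda>k\<in>carrier G. \<beta> k * \<chi> k) h)"
    proof (rule sum.reindex_bij_witness[of _ "\<lambda>\<chi>. \<lambda>k\<in>carrier G. \<beta> k * \<chi> k"
          "\<lambda>\<chi>. \<lambda>k\<in>carrier G. cnj (\<beta> k) * \<chi> k"])
      fix \<chi> assume \<chi>: "\<chi> \<in> ?C"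
      have *: "\<beta> k * (cnj (\<beta> k) * z) = z" "cnj (\<beta> k) * (\<beta> k * z) = z"
        if "k \<in> carrier G" for k z
        using character_mult_cnj[OF \<beta>(1) that] by (simp_all add: mult.left_commute flip: mult.assoc)
      show "(\<lambda>k\<in>carrier G. \<beta> k * (\<lambda>k\<in>carrier G. cnj (\<beta> k) * \<chi> k) k) = \<chi>"
        "(\<lambda>k\<in>carrier G. cnj (\<beta> k) * (\<lambda>k\<in>carrier G. \<beta> k * \<chi> k) k) = \<chi>"
        "(\<lambda>k\<in>carrier G. \<beta> k * (\<lambda>k\<in>carrier G. cnj (\<beta> k) * \<chi> k) k) h = \<chi> h"
        using character_extensional[OF \<chi>] h * by (auto simp: extensional_def fun_eq_iff)
      show "(\<lambda>k\<in>carrier G. \<beta> k * \<chi> k) \<in> ?C" "(\<lambda>k\<in>carrier G. cnj (\<beta> k) * \<chi> k) \<in> ?C"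
        using \<chi> \<beta> by (auto intro!: charactersI simp: character_mult cmod_character norm_mult)
    qed
    also have "\<dots> = \<beta> h * (\<Sum>\<chi>\<in>?C. \<chi> h)"
      using h by (simp add: sum_distrib_left)
    finally show ?thesis
      using \<beta> by simp
  qed
  \<comment> \<open>The trivial character turns a plain sum of \<open>\<chi>\<close> into an inner
    product, to which orthogonality applies.\<close>
  define \<epsilon> where "\<epsilon> = (\<lambda>h\<in>carrier G. 1::complex)"
  have \<epsilon>: "\<epsilon> \<in> ?C"
    unfolding \<epsilon>_def by (rule charactersI) auto
  \<comment> \<open>double counting gives as many characters as group elements\<close>
  have "(\<Sum>\<chi>\<in>?C. \<chi> \<one>) = (\<Sum>h\<in>carrier G. \<Sum>\<chi>\<in>?C. \<chi> h)"
    using fin vanish by (simp add: sum.remove[of _ \<one>])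
  also have "\<dots> = (\<Sum>\<chi>\<in>?C. \<Sum>h\<in>carrier G. \<chi> h * cnj (\<epsilon> h))"
    by (subst sum.swap) (simp add: \<epsilon>_def)
  also have "\<dots> = of_nat (order G)"
    using finite_characters[OF fin] \<epsilon> by (simp add: character_orthogonality sum.delta')
  finally show ?thesis
    using vanish[OF h] by auto
qed

end

subsection \<open>The Zak transform\<close>

lemma sum_fun_eq: "(\<Sum>i\<in>I. f i) = (\<lambda>x. \<Sum>i\<in>I. f i x :: complex)"
  by (induction I rule: infinite_finite_induct) (auto simp: fun_eq_iff)

text \<open>Lets facts about \<open>H\<close> as a group of its own simplify to facts about the
  characters in the theorem.\<close>

lemma characters_carrier_update [simp]: "characters (G\<lparr>carrier := H\<rparr>) H = characters G H"
  by (simp add: characters_def)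

locale abelian_subgroup_transversal = group G for G (structure) +
  fixes H \<Omega> :: "'a set"
  assumes finite_carrier: "finite (carrier G)"
    and subgroup_H: "subgroup H G"
    and abelian_H: "comm_group (G\<lparr>carrier := H\<rparr>)"
    and transversal_\<Omega>: "transversal G H \<Omega>"
begin

text \<open>Since \<open>G\<close> itself may be non-commutative, the character theory is imported
  for \<open>H\<close> alone.\<close>

sublocale K: comm_group "G\<lparr>carrier := H\<rparr>"
  by (rule abelian_H)

abbreviation zak where "zak \<equiv> Zr G H \<Omega>"

abbreviation chars where "chars \<equiv> characters G H"

lemmas H_mem = subgroup.mem_carrier[OF subgroup_H]
lemmas H_mult = subgroup.m_closed[OF subgroup_H]
lemmas H_inv = subgroup.m_inv_closed[OF subgroup_H]
lemmas H_one = subgroup.one_closed[OF subgroup_H]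

lemma finite_H: "finite H"
  using finite_carrier subgroup.subset[OF subgroup_H] finite_subset by blast

lemma card_H_nonzero: "of_nat (card H) \<noteq> (0::complex)"
  using finite_H H_one by auto

lemmas char_mult = K.character_mult[simplified]

lemma char_inv: "\<alpha> \<in> chars \<Longrightarrow> h \<in> H \<Longrightarrow> \<alpha> (inv h) = cnj (\<alpha> h)"
  using K.character_inv[of \<alpha> h] m_inv_consistent[OF subgroup_H] by simp

lemma \<Omega>_mem: "x \<in> \<Omega> \<Longrightarrow> x \<in> carrier G"
  using transversal_\<Omega> by (auto simp: transversal_def)

section \<open>Coset decomposition and inversion of the Zak transform\<close>

definition rep where "rep y = (THE x. x \<in> \<Omega> \<and> x \<in> y <# H)"

lemma mem_l_coset_iff:
  assumes "y \<in> carrier G"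
  shows "x \<in> y <# H \<longleftrightarrow> x \<in> carrier G \<and> inv x \<otimes> y \<in> H"
proof
  assume "x \<in> y <# H"
  then obtain h where h: "h \<in> H" "x = y \<otimes> h"
    by (auto simp: l_coset_def)
  hence "inv x \<otimes> y = inv h"
    using assms by (simp add: H_mem inv_mult_group m_assoc)
  thus "x \<in> carrier G \<and> inv x \<otimes> y \<in> H"
    using assms h by (simp add: H_mem H_inv)
next
  assume x: "x \<in> carrier G \<and> inv x \<otimes> y \<in> H"
  have "x = y \<otimes> inv (inv x \<otimes> y)"
    using x assms by (simp add: inv_mult_group flip: m_assoc)
  thus "x \<in> y <# H"
    using x H_inv[of "inv x \<otimes> y"] unfolding l_coset_def by blast
qed

lemma ex1_rep:
  assumes "y \<in> carrier G"
  shows "\<exists>!x. x \<in> \<Omega> \<and> x \<in> y <# H"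
  using transversal_\<Omega> assms by (auto simp: transversal_def LCOSETS_def)

lemma
  assumes "y \<in> carrier G"
  shows rep_mem: "rep y \<in> \<Omega>" and rep_inv_mult: "inv (rep y) \<otimes> y \<in> H"
  using theI'[OF ex1_rep[OF assms]] mem_l_coset_iff[OF assms] unfolding rep_def by auto

lemma rep_mult:
  assumes "x \<in> \<Omega>" "h \<in> H"
  shows "rep (x \<otimes> h) = x"
proof -
  have xh: "x \<in> carrier G" "h \<in> carrier G"
    using assms by (auto intro: \<Omega>_mem H_mem)
  have "x \<in> x \<otimes> h <# H"
    using xh assms by (simp add: mem_l_coset_iff flip: m_assoc)
  thus ?thesis
    unfolding rep_def using assms xh by (intro the1_equality ex1_rep) auto
qed

lemma carrier_decompose:
  assumes "y \<in> carrier G"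
  obtains x h where "x \<in> \<Omega>" "h \<in> H" "y = x \<otimes> h"
proof
  show "y = rep y \<otimes> (inv (rep y) \<otimes> y)"
    using \<Omega>_mem[OF rep_mem[OF assms]] assms by (simp flip: m_assoc)
qed (use assms rep_mem rep_inv_mult in auto)

text \<open>For \<open>y = x \<otimes> h\<close> with \<open>x\<close> in \<open>\<Omega>\<close>
  and \<open>h\<close> in \<open>H\<close>, the term \<open>inv (rep y) \<otimes> y\<close> recovers
  \<open>h\<close>. Division by \<open>card H\<close> makes the transform at \<open>\<alpha>\<close>
  return \<open>g\<close> itself when \<open>g\<close> is supported on
  \<open>\<Omega>\<close>.\<close>

definition zak_inv where
  "zak_inv \<alpha> g = (\<lambda>y. if y \<in> carrier G
     then g (rep y) * cnj (\<alpha> (inv (rep y) \<otimes> y)) / of_nat (card H) else (0::complex))"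

lemma zak_inv_mult:
  assumes "x \<in> \<Omega>" "h \<in> H"
  shows "zak_inv \<alpha> g (x \<otimes> h) = g x * cnj (\<alpha> h) / of_nat (card H)"
  using assms by (simp add: zak_inv_def rep_mult \<Omega>_mem H_mem flip: m_assoc)

lemma zak_inv_in_L2: "zak_inv \<alpha> g \<in> L2 (carrier G)"
  by (simp add: zak_inv_def L2_def)

lemma zak_in_L2: "zak f \<alpha> \<in> L2 \<Omega>"
  by (simp add: Zr_def L2_def)

text \<open>At a point of \<open>\<Omega>\<close> the transform is a multiple of the inner product
  of \<open>\<beta>\<close> with \<open>\<alpha>\<close>, so orthogonality decides its
  value.\<close>

lemma zak_zak_inv:
  assumes "g \<in> L2 \<Omega>" "\<alpha> \<in> chars" "\<beta> \<in> chars"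
  shows "zak (zak_inv \<alpha> g) \<beta> = (if \<beta> = \<alpha> then g else 0)"
proof
  fix x
  show "zak (zak_inv \<alpha> g) \<beta> x = (if \<beta> = \<alpha> then g else 0) x"
  proof (cases "x \<in> \<Omega>")
    case True
    have "zak (zak_inv \<alpha> g) \<beta> x = g x / of_nat (card H) * (\<Sum>h\<in>H. \<beta> h * cnj (\<alpha> h))"
      using True by (simp add: Zr_def zak_inv_mult sum_distrib_left mult_ac)
    thus ?thesis
      using K.character_orthogonality[of \<beta> \<alpha>] assms card_H_nonzero by (simp add: order_def)
  next
    case False
    thus ?thesis
      using assms by (auto simp: Zr_def L2_def)
  qed
qed

text \<open>Shifting the summation variable by \<open>k\<close> pulls out the factor
  \<open>cnj (\<alpha> k)\<close> that \<open>zak_inv\<close> carries at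
  \<open>x \<otimes> k\<close>.\<close>

lemma zak_inv_zak_mult:
  assumes "\<alpha> \<in> chars" "x \<in> \<Omega>" "k \<in> H"
  shows "zak_inv \<alpha> (zak f \<alpha>) (x \<otimes> k) = (\<Sum>h\<in>H. f (x \<otimes> k \<otimes> h) * \<alpha> h) / of_nat (card H)"
proof -
  have "(\<Sum>h\<in>H. f (x \<otimes> k \<otimes> h) * \<alpha> h) = (\<Sum>h\<in>H. f (x \<otimes> h) * \<alpha> (inv k \<otimes> h))"
    using assms
    by (intro sum.reindex_bij_witness[of _ "\<lambda>h. inv k \<otimes> h" "\<lambda>h. k \<otimes> h"])
      (auto simp: H_mem H_mult H_inv \<Omega>_mem m_assoc[symmetric])
  also have "\<dots> = (\<Sum>h\<in>H. f (x \<otimes> h) * \<alpha> h) * cnj (\<alpha> k)"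
    using assms by (simp add: char_mult H_inv char_inv sum_distrib_left mult_ac)
  finally show ?thesis
    using assms by (simp add: zak_inv_mult Zr_def)
qed

text \<open>As a combination of translates, the reconstruction from a single character stays in every
  shift-invariant subspace containing \<open>f\<close>.\<close>

lemma zak_inv_zak:
  assumes "\<alpha> \<in> chars"
  shows "zak_inv \<alpha> (zak f \<alpha>) = (\<Sum>h\<in>H. cfun_scale (\<alpha> h / of_nat (card H)) (right_translation G h f))"
proof
  fix y
  show "zak_inv \<alpha> (zak f \<alpha>) y =
    (\<Sum>h\<in>H. cfun_scale (\<alpha> h / of_nat (card H)) (right_translation G h f)) y"
  proof (cases "y \<in> carrier G")
    case True
    then obtain x k where "x \<in> \<Omega>" "k \<in> H" "y = x \<otimes> k"
      by (rule carrier_decompose)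
    thus ?thesis
      using assms True
      by (simp add: zak_inv_zak_mult sum_fun_eq cfun_scale_def right_translation_def
          sum_divide_distrib mult_ac)
  next
    case False
    thus ?thesis
      by (simp add: zak_inv_def sum_fun_eq cfun_scale_def right_translation_def)
  qed
qed

text \<open>Summing over the characters first leaves only the term \<open>h = \<one>\<close>, whose
  weight \<open>card H\<close> cancels the normalisation.\<close>

lemma zak_inversion:
  assumes "f \<in> L2 (carrier G)"
  shows "(\<Sum>\<alpha>\<in>chars. zak_inv \<alpha> (zak f \<alpha>)) = f"
proof
  fix y
  show "(\<Sum>\<alpha>\<in>chars. zak_inv \<alpha> (zak f \<alpha>)) y = f y"
  proof (cases "y \<in> carrier G")
    case True
    then obtain x k where xk: "x \<in> \<Omega>" "k \<in> H" "y = x \<otimes> k"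
      by (rule carrier_decompose)
    have "(\<Sum>\<alpha>\<in>chars. zak_inv \<alpha> (zak f \<alpha>)) y =
        (\<Sum>\<alpha>\<in>chars. \<Sum>h\<in>H. f (y \<otimes> h) * \<alpha> h) / of_nat (card H)"
      using xk by (simp add: sum_fun_eq zak_inv_zak_mult sum_divide_distrib)
    also have "(\<Sum>\<alpha>\<in>chars. \<Sum>h\<in>H. f (y \<otimes> h) * \<alpha> h) = (\<Sum>h\<in>H. f (y \<otimes> h) * (\<Sum>\<alpha>\<in>chars. \<alpha> h))"
      by (subst sum.swap) (simp add: sum_distrib_left)
    also have "\<dots> = (\<Sum>h\<in>H. if h = \<one> then f y * of_nat (card H) else 0)"
      using K.sum_characters finite_H True by (intro sum.cong) (auto simp: order_def)
    also have "\<dots> = f y * of_nat (card H)"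
      using finite_H H_one by simp
    finally show ?thesis
      using card_H_nonzero by simp
  next
    case False
    thus ?thesis
      using assms by (simp add: sum_fun_eq zak_inv_def L2_def)
  qed
qed

section \<open>Linearity and behaviour under translation\<close>

lemma zak_linear: "module_hom cfun_scale cfun_scale (\<lambda>f. zak f \<alpha>)"
  by unfold_locales
    (auto simp: Zr_def cfun_scale_def fun_eq_iff algebra_simps sum.distrib sum_distrib_left)

text \<open>Reindexing by \<open>inv k\<close> turns a translation into a scalar factor, under which
  every fibre subspace is stable.\<close>

lemma zak_right_translation:
  assumes "\<alpha> \<in> chars" "k \<in> H"
  shows "zak (right_translation G k f) \<alpha> = cfun_scale (cnj (\<alpha> k)) (zak f \<alpha>)"
proof
  fix x
  show "zak (right_translation G k f) \<alpha> x = cfun_scale (cnj (\<alpha> k)) (zak f \<alpha>) x"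
  proof (cases "x \<in> \<Omega>")
    case True
    have "(\<Sum>h\<in>H. f (x \<otimes> h \<otimes> k) * \<alpha> h) = (\<Sum>h\<in>H. f (x \<otimes> h) * \<alpha> (h \<otimes> inv k))"
      using assms True
      by (intro sum.reindex_bij_witness[of _ "\<lambda>h. h \<otimes> inv k" "\<lambda>h. h \<otimes> k"])
        (auto simp: H_mem H_mult H_inv \<Omega>_mem m_assoc)
    also have "\<dots> = cnj (\<alpha> k) * (\<Sum>h\<in>H. f (x \<otimes> h) * \<alpha> h)"
      using assms by (simp add: char_mult H_inv char_inv sum_distrib_left mult_ac)
    finally show ?thesis
      using True by (simp add: Zr_def right_translation_def cfun_scale_def H_mem \<Omega>_mem)
  next
    case False
    thus ?thesis
      by (simp add: Zr_def cfun_scale_def)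
  qed
qed

lemma right_translation_inv:
  assumes "f \<in> L2 (carrier G)" "k \<in> H"
  shows "right_translation G k (right_translation G (inv k) f) = f"
  using assms by (auto simp: right_translation_def L2_def fun_eq_iff H_mem m_assoc)

lemma subspaces_L2_0: "V \<in> subspaces_L2 A \<Longrightarrow> 0 \<in> V"
  by (auto simp: subspaces_L2_def cfun.subspace_0)

lemma subspace_L2: "cfun.subspace (L2 A)"
  by (auto simp: cfun.subspace_def L2_def cfun_scale_def)

section \<open>From range functions to shift-invariant subspaces\<close>

lemma range_space_eq:
  "range_space G H \<Omega> J = L2 (carrier G) \<inter> (\<Inter>\<alpha>\<in>chars. (\<lambda>f. zak f \<alpha>) -` J \<alpha>)"
  by (auto simp: range_space_def)

lemma right_translation_range_space:
  assumes J: "J \<in> range_functions G H \<Omega>" and "k \<in> H" "f \<in> range_space G H \<Omega> J"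
  shows "right_translation G k f \<in> range_space G H \<Omega> J"
proof -
  have "cfun.subspace (J \<alpha>)" if "\<alpha> \<in> chars" for \<alpha>
    using J that by (auto simp: range_functions_def subspaces_L2_def)
  thus ?thesis
    using assms
    by (simp add: range_space_def zak_right_translation cfun.subspace_scale)
      (simp add: L2_def right_translation_def)
qed

lemma range_space_shift_invariant:
  assumes J: "J \<in> range_functions G H \<Omega>"
  shows "range_space G H \<Omega> J \<in> shift_invariant_subspaces G H"
proof -
  \<comment> \<open>An intersection of preimages of subspaces under linear maps is a
    subspace.\<close>
  have "cfun.subspace (range_space G H \<Omega> J)"
    unfolding range_space_eq using J
    by (intro cfun.subspace_inter subspace_L2 cfun.subspace_Inter ballI)
      (auto simp: range_functions_def subspaces_L2_def intro: module_hom.subspace_vimage[OF zak_linear])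
  moreover have "right_translation G k ` range_space G H \<Omega> J = range_space G H \<Omega> J" if k: "k \<in> H" for k
  proof
    show "right_translation G k ` range_space G H \<Omega> J \<subseteq> range_space G H \<Omega> J"
      using right_translation_range_space[OF J k] by blast
    show "range_space G H \<Omega> J \<subseteq> right_translation G k ` range_space G H \<Omega> J"
    proof
      fix f assume f: "f \<in> range_space G H \<Omega> J"
      \<comment> \<open>Equality needs a preimage of \<open>f\<close>: its translate by
        \<open>inv k\<close>, which stays in the space.\<close>
      hence "f = right_translation G k (right_translation G (inv k) f)"
        using k by (simp add: right_translation_inv range_space_def)
      thus "f \<in> right_translation G k ` range_space G H \<Omega> J"
        using right_translation_range_space[OF J H_inv[OF k] f] by blast
    qed
  qed
  ultimately show ?thesis
    by (auto simp: shift_invariant_subspaces_def subspaces_L2_def range_space_def)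
qed

section \<open>The inverse correspondence by fibres\<close>

definition range_function where
  "range_function V = (\<lambda>\<alpha>\<in>chars. (\<lambda>f. zak f \<alpha>) ` V)"

text \<open>Each \<open>g\<close> in \<open>J \<alpha>\<close> is attained by
  \<open>zak_inv \<alpha> g\<close>: its transform is 0 at every other character, and 0 lies in
  every subspace.\<close>

lemma range_function_range_space:
  assumes J: "J \<in> range_functions G H \<Omega>"
  shows "range_function (range_space G H \<Omega> J) = J"
proof (rule extensionalityI[of _ chars])
  fix \<alpha> assume \<alpha>: "\<alpha> \<in> chars"
  have J_sub: "J \<beta> \<in> subspaces_L2 \<Omega>" if "\<beta> \<in> chars" for \<beta>
    using J that by (auto simp: range_functions_def)
  have "g \<in> (\<lambda>f. zak f \<alpha>) ` range_space G H \<Omega> J" if g: "g \<in> J \<alpha>" for g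
  proof
    have gL: "g \<in> L2 \<Omega>"
      using J_sub[OF \<alpha>] g by (auto simp: subspaces_L2_def)
    thus "g = zak (zak_inv \<alpha> g) \<alpha>"
      using \<alpha> by (simp add: zak_zak_inv)
    show "zak_inv \<alpha> g \<in> range_space G H \<Omega> J"
      using g gL \<alpha> subspaces_L2_0[OF J_sub] by (simp add: range_space_def zak_inv_in_L2 zak_zak_inv)
  qed
  thus "range_function (range_space G H \<Omega> J) \<alpha> = J \<alpha>"
    using \<alpha> by (auto simp: range_function_def range_space_def)
qed (use J in \<open>auto simp: range_function_def range_functions_def PiE_def\<close>)

lemma range_function_in_range_functions:
  assumes "V \<in> shift_invariant_subspaces G H"
  shows "range_function V \<in> range_functions G H \<Omega>"
  using assms module_hom.subspace_image[OF zak_linear]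
  by (auto simp: range_function_def range_functions_def subspaces_L2_def
      shift_invariant_subspaces_def intro: zak_in_L2)

text \<open>At each \<open>\<alpha>\<close> some \<open>g\<close> in \<open>V\<close>, depending on
  \<open>\<alpha>\<close>, shares the transform of \<open>f\<close>. Reconstruction from
  \<open>\<alpha>\<close> sees only that value, so it lies in \<open>V\<close>, and these pieces sum
  to \<open>f\<close>.\<close>

lemma range_space_range_function:
  assumes V: "V \<in> shift_invariant_subspaces G H"
  shows "range_space G H \<Omega> (range_function V) = V"
proof
  have sub: "cfun.subspace V" and V_L2: "V \<subseteq> L2 (carrier G)"
    and inv: "\<And>h f. h \<in> H \<Longrightarrow> f \<in> V \<Longrightarrow> right_translation G h f \<in> V"
    using V by (auto simp: shift_invariant_subspaces_def subspaces_L2_def)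
  show "V \<subseteq> range_space G H \<Omega> (range_function V)"
    using V_L2 by (auto simp: range_space_def range_function_def)
  show "range_space G H \<Omega> (range_function V) \<subseteq> V"
  proof
    fix f assume f: "f \<in> range_space G H \<Omega> (range_function V)"
    have "zak_inv \<alpha> (zak f \<alpha>) \<in> V" if \<alpha>: "\<alpha> \<in> chars" for \<alpha>
    proof -
      obtain g where "g \<in> V" "zak f \<alpha> = zak g \<alpha>"
        using f \<alpha> by (auto simp: range_space_def range_function_def)
      thus ?thesis
        using \<alpha> by (simp add: zak_inv_zak cfun.subspace_sum cfun.subspace_scale sub inv)
    qed
    hence "(\<Sum>\<alpha>\<in>chars. zak_inv \<alpha> (zak f \<alpha>)) \<in> V"
      by (intro cfun.subspace_sum sub)
    thus "f \<in> V"
      using f by (simp add: zak_inversion range_space_def)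
  qed
qed

end

theorem corollary1:
  fixes G :: "('a, 'b) monoid_scheme" and H \<Omega> :: "'a set"
  assumes "group G" and "finite (carrier G)"
    and "subgroup H G" and "comm_group (G\<lparr>carrier := H\<rparr>)"
    and "transversal G H \<Omega>"
  shows "bij_betw (range_space G H \<Omega>) (range_functions G H \<Omega>) (shift_invariant_subspaces G H)"
proof -
  interpret abelian_subgroup_transversal G H \<Omega>
    using assms by (simp add: abelian_subgroup_transversal_def abelian_subgroup_transversal_axioms_def)
  show ?thesis
    by (rule bij_betw_byWitness[where f' = range_function])
      (auto simp: range_function_range_space range_space_range_function
        range_space_shift_invariant range_function_in_range_functions)
qed

end
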